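(* Let $0\le\alpha\le1$, let $f\in\mathcal{BS}(\alpha)$, and let $\gamma_n$ ($n\ge1$) be the logarithmic coefficients of $f$, defined by $$\log\frac{f(z)}{z}=2\sum_{n=1}^\infty\gamma_nz^n,\qquad z\in\mathbb{D}.$$ Then: (i) for every $0\le\alpha\le1$ and $n=1,2,3$, the inequality $|\gamma_n|\le\frac{1}{2n}$ holds and is sharp (equality is attained by some function in $\mathcal{BS}(\alpha)$); (ii) for $0\le\alpha\le3-2\sqrt2$, the inequality $|\gamma_n|\le\frac1{2n}$ holds for all $n\in\mathbb{N}$ and is sharp (for each $n$ equality is attained by some function in $\mathcal{BS}(\alpha)$); (iii) for every $0\le\alpha\le1$ and every $n\in\mathbb{N}$, $|\gamma_n|\le\frac12$.
   Context: $\mathbb{D}=\{z\in\mathbb{C}:|z|<1\}$, $\mathbb{N}=\{1,2,3,\dots\}$. $\mathcal{A}$ is the class of analytic functions $f$ in $\mathbb{D}$ with $f(0)=0$, $f'(0)=1$. For analytic $f,g$ in $\mathbb{D}$, $f$ is subordinate to $g$, written $f\prec g$, if there is an analytic $\omega:\mathbb{D}\to\mathbb{D}$ with $\omega(0)=0$ and $f(z)=g(\omega(z))$ for all $z\in\mathbb{D}$. For $0\le\alpha\le1$ let $F_\alpha(z)=\dfrac{z}{1-\alpha z^2}$, and let $\mathcal{BS}(\alpha)$ be the class of $f\in\mathcal{A}$ such that $\dfrac{zf'(z)}{f(z)}-1\prec F_\alpha(z)$ (in particular $zf'(z)/f(z)$ is analytic in $\mathbb{D}$, so $f(z)/z$ has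 no zeros in $\mathbb{D}$). The function $\log(f(z)/z)$ is the analytic branch in $\mathbb{D}$ vanishing at $z=0$, where $f(z)/z$ takes the value $1$. *)

theory Defs
  imports "HOL-Complex_Analysis.Complex_Analysis"
begin

abbreviation unit_disc :: "complex set" where
  "unit_disc \<equiv> ball 0 1"

definition class_A :: "(complex \<Rightarrow> complex) set" where
  "class_A = {f. f holomorphic_on unit_disc \<and> f 0 = 0 \<and> deriv f 0 = 1}"

definition subordinate :: "(complex \<Rightarrow> complex) \<Rightarrow> (complex \<Rightarrow> complex) \<Rightarrow> bool"
    (infix "\<prec>\<^sub>s" 50) where
  "f \<prec>\<^sub>s g \<longleftrightarrow> f holomorphic_on unit_disc \<and> g holomorphic_on unit_disc \<and>
     (\<exists>\<omega>. \<omega> holomorphic_on unit_disc \<and> \<omega> \<in> unit_disc \<rightarrow> unit_disc \<and> \<omega> 0 = 0 \<and>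
          (\<forall>z\<in>unit_disc. f z = g (\<omega> z)))"

definition F_booth :: "real \<Rightarrow> complex \<Rightarrow> complex" where
  "F_booth \<alpha> z = z / (1 - of_real \<alpha> * z ^ 2)"

text \<open>The analytic function $z f'(z)/f(z)$ for \<open>f\<close> in the class A; its singularity
  at the origin is removable, with value 1.\<close>

definition log_diff :: "(complex \<Rightarrow> complex) \<Rightarrow> complex \<Rightarrow> complex" where
  "log_diff f z = (if z = 0 then 1 else z * deriv f z / f z)"

text \<open>The requirement that \<open>f\<close> has no zeros other than the origin is implied by the analyticity
  of $z f'(z)/f(z)$. It is stated explicitly so that no value of \<open>log_diff\<close> rests on
  the convention $x / 0 = 0$.\<close>

definition BS :: "real \<Rightarrow> (complex \<Rightarrow> complex) set" where
  "BS \<alpha> = {f \<in> class_A. (\<forall>z\<in>unit_disc - {0}. f z \<noteq> 0) \<and>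
                         (\<lambda>z. log_diff f z - 1) \<prec>\<^sub>s F_booth \<alpha>}"

text \<open>The analytic branch of $\log (f(z)/z)$ that vanishes at the origin. On the unit disc it is
  uniquely determined; outside the disc its values are irrelevant.\<close>

definition is_log_branch :: "(complex \<Rightarrow> complex) \<Rightarrow> (complex \<Rightarrow> complex) \<Rightarrow> bool" where
  "is_log_branch f L \<longleftrightarrow> L holomorphic_on unit_disc \<and> L 0 = 0 \<and>
     (\<forall>z\<in>unit_disc - {0}. exp (L z) = f z / z)"

definition log_branch :: "(complex \<Rightarrow> complex) \<Rightarrow> complex \<Rightarrow> complex" where
  "log_branch f = (SOME L. is_log_branch f L)"

text \<open>Half the Taylor coefficients at the origin of $\log (f(z)/z)$; the defining expansion
  is the lemma \<open>log_coeff_sums\<close> below.\<close>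

definition log_coeff :: "(complex \<Rightarrow> complex) \<Rightarrow> nat \<Rightarrow> complex" where
  "log_coeff f n = fps_nth (fps_expansion (log_branch f) 0) n / 2"

lemma is_log_branch_log_branch:
  assumes "f \<in> BS \<alpha>"
  shows "is_log_branch f (log_branch f)"
proof -
  have holf: "f holomorphic_on unit_disc" and f0: "f 0 = 0" and df: "deriv f 0 = 1"
    and nz: "\<And>z. z \<in> unit_disc - {0} \<Longrightarrow> f z \<noteq> 0"
    using assms by (auto simp: BS_def class_A_def)
  define h where "h = (\<lambda>z. if z = 0 then deriv f 0 else (f z - f 0) / (z - 0))"
  have holh: "h holomorphic_on unit_disc"
    unfolding h_def by (rule pole_lemma_open[OF holf]) auto
  have hnz: "\<And>z. z \<in> unit_disc \<Longrightarrow> h z \<noteq> 0"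
    using nz by (auto simp: h_def df f0)
  obtain g where holg: "g holomorphic_on unit_disc"
    and g: "\<And>z. z \<in> unit_disc \<Longrightarrow> h z = exp (g z)"
    using contractible_imp_holomorphic_log[OF holh _ hnz]
      convex_imp_contractible[OF convex_ball] by metis
  have "exp (g 0) = 1"
    using g[of 0] by (simp add: h_def df)
  then have "is_log_branch f (\<lambda>z. g z - g 0)"
    unfolding is_log_branch_def
    by (auto simp: exp_diff g[symmetric] h_def f0 intro!: holomorphic_intros holg)
  then show ?thesis
    unfolding log_branch_def by (rule someI[of "is_log_branch f"])
qed

lemma is_log_branch_unique:
  assumes "is_log_branch f L" "is_log_branch f M" "z \<in> unit_disc"
  shows "L z = M z"
proof -
  have hol: "L holomorphic_on unit_disc" "M holomorphic_on unit_disc"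
    using assms by (auto simp: is_log_branch_def)
  define D where "D = (\<lambda>z. L z - M z)"
  have holD: "D holomorphic_on unit_disc"
    unfolding D_def by (intro holomorphic_intros hol)
  have eq: "exp (L w) = exp (M w)" if "w \<in> unit_disc" for w
    using assms that by (cases "w = 0") (auto simp: is_log_branch_def)
  have eD: "exp (D w) = 1" if "w \<in> unit_disc" for w
    using eq[OF that] by (simp add: D_def exp_diff)
  have d0: "(D has_field_derivative 0) (at w)" if w: "w \<in> unit_disc" for w
  proof -
    have D: "(D has_field_derivative deriv D w) (at w)"
      using holD w by (intro holomorphic_derivI) auto
    then have "((\<lambda>u. exp (D u)) has_field_derivative exp (D w) * deriv D w) (at w)"
      by (rule DERIV_fun_exp)
    moreover have "((\<lambda>u. exp (D u)) has_field_derivative 0) (at w)"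
      by (rule has_field_derivative_transform_within_open[OF DERIV_const[of 1] open_ball w])
         (simp add: eD)
    ultimately have "exp (D w) * deriv D w = 0"
      by (rule DERIV_unique)
    with D show ?thesis by simp
  qed
  obtain c where "\<And>w. w \<in> unit_disc \<Longrightarrow> D w = c"
    using has_field_derivative_zero_constant[OF convex_ball, of 0 1 D] d0
      has_field_derivative_at_within by metis
  then have "D z = D 0"
    using assms(3) by simp
  then show ?thesis
    using assms by (simp add: D_def is_log_branch_def)
qed

lemma log_coeff_sums:
  assumes "f \<in> BS \<alpha>" "z \<in> unit_disc"
  shows "(\<lambda>n. 2 * (log_coeff f (Suc n) * z ^ Suc n)) sums log_branch f z"
proof -
  have L: "log_branch f holomorphic_on unit_disc" "log_branch f 0 = 0"
    using is_log_branch_log_branch[OF assms(1)] by (auto simp: is_log_branch_def)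
  have "(\<lambda>n. (deriv ^^ n) (log_branch f) 0 / fact n * (z - 0) ^ n) sums log_branch f z"
    using L(1) assms(2) by (rule holomorphic_power_series)
  then have "(\<lambda>n. 2 * (log_coeff f n * z ^ n)) sums log_branch f z"
    by (simp add: log_coeff_def fps_expansion_def)
  then show ?thesis
    by (subst sums_Suc_iff) (simp add: log_coeff_def fps_expansion_def L(2))
qed

end

theory Submission
  imports Defs
begin

text \<open>All three parts follow from the bound $1/(2n)$, which holds for every \<open>n\<close> and every
  $0 \le \alpha \le 1$. If $L = \log (f(z)/z)$, then $z L'(z) = F_\alpha(\omega(z))$, and partial
  fractions write $F_\alpha(w)$ as the mean of $w/(1 - aw)$ over $a = \pm\sqrt\alpha$. Each of these
  Moebius maps is convex on the disc with derivative 1 at the origin, so by Rogosinski's theorem the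
  coefficients of $\omega/(1 - a\omega)$ have modulus at most 1, although $F_\alpha$ itself
  is convex only for $\alpha \le 3 - 2\sqrt 2$.\<close>

section \<open>Coefficients of functions bounded by 1\<close>

text \<open>Cauchy's inequality on circles of radius r < 1, followed by r tending to 1, since
  \<open>f\<close> is controlled only on the open disc.\<close>

lemma norm_fps_expansion_le_1:
  assumes hol: "f holomorphic_on unit_disc" and bd: "\<And>z. z \<in> unit_disc \<Longrightarrow> norm (f z) \<le> 1"
  shows "norm (fps_nth (fps_expansion f 0) n) \<le> 1"
proof -
  define c where "c = norm (fps_nth (fps_expansion f 0) n)"
  have *: "c * r ^ n \<le> 1" if r: "0 < r" "r < 1" for r
  proof -
    have sub: "cball (0::complex) r \<subseteq> unit_disc"
      using r by auto
    have "norm ((deriv ^^ n) f 0) \<le> fact n * 1 / r ^ n"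
    proof (rule Cauchy_inequality)
      show "f holomorphic_on ball 0 r"
        using hol sub by (meson ball_subset_cball holomorphic_on_subset order_trans)
      show "continuous_on (cball 0 r) f"
        using hol sub by (meson continuous_on_subset holomorphic_on_imp_continuous_on)
    qed (use r bd in auto)
    then show ?thesis
      using r by (simp add: c_def fps_expansion_def norm_divide field_simps)
  qed
  have "((\<lambda>r. c * r ^ n) \<longlongrightarrow> c * 1 ^ n) (at_left (1::real))"
    by (intro tendsto_intros)
  moreover have "eventually (\<lambda>r. c * r ^ n \<le> 1) (at_left (1::real))"
    using eventually_at_left_real[OF zero_less_one] by (rule eventually_mono) (use * in auto)
  ultimately show ?thesis
    using tendsto_upperbound[of "\<lambda>r. c * r ^ n" "c * 1 ^ n" "at_left 1" 1]
    by (simp add: c_def)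
qed

section \<open>Convexity of the Moebius images\<close>

text \<open>Squaring both norms exposes the geometry: the solution set is a disc for |a| < 1 and a
  half-plane for |a| = 1.\<close>

lemma norm_less_norm_1_plus_iff:
  fixes z :: complex
  shows "norm z < norm (1 + of_real a * z) \<longleftrightarrow> (1 - a\<^sup>2) * (norm z)\<^sup>2 - 2 * a * Re z < 1"
proof -
  have "norm z < norm (1 + of_real a * z) \<longleftrightarrow> (norm z)\<^sup>2 < (norm (1 + of_real a * z))\<^sup>2"
    by (meson norm_ge_zero power_less_imp_less_base power_strict_mono zero_less_numeral)
  also have "\<dots> \<longleftrightarrow> (1 - a\<^sup>2) * (norm z)\<^sup>2 - 2 * a * Re z < 1"
    unfolding cmod_power2 by (simp add: algebra_simps power2_eq_square)
  finally show ?thesis .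
qed

text \<open>This set is the image of the unit disc under $w \mapsto w / (1 - a w)$.\<close>

lemma convex_moebius_image:
  fixes a :: real
  assumes "\<bar>a\<bar> \<le> 1"
  shows "convex {z :: complex. norm z < norm (1 + of_real a * z)}"
proof (rule convexI, unfold mem_Collect_eq norm_less_norm_1_plus_iff)
  fix x y :: complex and u v :: real
  assume x: "(1 - a\<^sup>2) * (norm x)\<^sup>2 - 2 * a * Re x < 1"
    and y: "(1 - a\<^sup>2) * (norm y)\<^sup>2 - 2 * a * Re y < 1"
    and uv: "0 \<le> u" "0 \<le> v" "u + v = 1"
  have v: "v = 1 - u" using uv by simp
  have a: "1 - a\<^sup>2 \<ge> 0"
    using assms by (simp add: abs_square_le_1)
  \<comment> \<open>For weights with sum 1 the squared norm falls short of linear interpolation by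
    exactly u v |x - y|^2. Dropping this term gives convexity of the quadratic part.\<close>
  have id: "(norm (u *\<^sub>R x + v *\<^sub>R y))\<^sup>2 = u * (norm x)\<^sup>2 + v * (norm y)\<^sup>2 - u * v * (norm (x - y))\<^sup>2"
    unfolding cmod_power2 v by (simp add: algebra_simps power2_eq_square)
  have "(1 - a\<^sup>2) * (norm (u *\<^sub>R x + v *\<^sub>R y))\<^sup>2 \<le> (1 - a\<^sup>2) * (u * (norm x)\<^sup>2 + v * (norm y)\<^sup>2)"
    using a uv by (intro mult_left_mono) (auto simp: id)
  then have "(1 - a\<^sup>2) * (norm (u *\<^sub>R x + v *\<^sub>R y))\<^sup>2 - 2 * a * Re (u *\<^sub>R x + v *\<^sub>R y)
      \<le> u * ((1 - a\<^sup>2) * (norm x)\<^sup>2 - 2 * a * Re x) + v * ((1 - a\<^sup>2) * (norm y)\<^sup>2 - 2 * a * Re y)"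
    by (simp add: algebra_simps)
  also have "\<dots> < 1"
    by (rule convex_bound_lt[OF x y uv])
  finally show "(1 - a\<^sup>2) * (norm (u *\<^sub>R x + v *\<^sub>R y))\<^sup>2 - 2 * a * Re (u *\<^sub>R x + v *\<^sub>R y) < 1" .
qed

section \<open>Rogosinski's coefficient theorem for Moebius images\<close>

text \<open>A geometric sum whose ratio has n-th power 1 but is not 1 itself, because n does not
  divide m.\<close>

lemma sum_powers_root_of_unity:
  assumes "0 < m" "m < n"
  shows "(\<Sum>k<n. (exp (2 * of_real pi * \<i> / of_nat n) ^ k) ^ m) = (0 :: complex)"
proof -
  let ?z = "exp (2 * of_real pi * \<i> / of_nat n) ^ m :: complex"
  have e: "?z = exp (2 * of_real pi * \<i> * of_nat m / of_nat n)"
    by (simp flip: exp_of_nat_mult add: mult_ac)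
  have ne: "?z \<noteq> 1"
    unfolding e using complex_root_unity_eq_1[of n m] assms nat_dvd_not_less by auto
  have "?z ^ n = 1"
    unfolding e using complex_root_unity[of n m] assms by auto
  then have "(\<Sum>k<n. ?z ^ k) = 0"
    using ne by (simp add: geometric_sum)
  then show ?thesis
    by (simp add: mult.commute flip: power_mult)
qed

text \<open>The inequality on \<open>h\<close> says that its values lie in the image of the disc
  under w / (1 - a w). The rotation average \<open>H\<close> keeps the n-th coefficient of
  \<open>h\<close>; pulling \<open>H\<close> back to the disc gives \<open>W\<close>, which has the
  same n-th coefficient and is bounded by 1.\<close>

lemma norm_fps_expansion_moebius_subordinate_le_1:
  assumes hol: "h holomorphic_on unit_disc" and h0: "h 0 = 0"
    and bd: "\<And>z. z \<in> unit_disc \<Longrightarrow> norm (h z) < norm (1 + of_real a * h z)"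
    and a: "\<bar>a\<bar> \<le> 1" and n: "n > 0"
  shows "norm (fps_nth (fps_expansion h 0) n) \<le> 1"
proof -
  \<comment> \<open>Averaging over the rotations by \<open>n\<close>-th roots of unity kills all coefficients of index
    strictly between 0 and \<open>n\<close> and, by convexity, stays in the Moebius image of the disc.\<close>
  define \<zeta> :: complex where "\<zeta> = exp (2 * of_real pi * \<i> / of_nat n)"
  define H where "H = (\<lambda>z. \<Sum>k<n. (1 / of_nat n) * h (\<zeta> ^ k * z))"
  \<comment> \<open>w = z / (1 + a z) inverts z = w / (1 - a w).\<close>
  define W where "W = (\<lambda>z. H z / (1 + of_real a * H z))"
  have nz: "norm (\<zeta> ^ k) = 1" for k
    by (simp add: \<zeta>_def norm_power)
  have in_disc: "\<zeta> ^ k * z \<in> unit_disc" if "z \<in> unit_disc" for k z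
    using that nz[of k] by (simp add: norm_mult)
  have holk: "(\<lambda>z. h (\<zeta> ^ k * z)) holomorphic_on unit_disc" for k
    using holomorphic_on_compose_gen[of "\<lambda>z. \<zeta> ^ k * z" unit_disc h unit_disc] hol in_disc
    by (auto simp: o_def image_subset_iff intro!: holomorphic_intros)
  have holH: "H holomorphic_on unit_disc"
    unfolding H_def by (intro holomorphic_intros holk)
  have bdH: "norm (H z) < norm (1 + of_real a * H z)" if z: "z \<in> unit_disc" for z
  proof -
    have "(\<Sum>k<n. (1 / real n) *\<^sub>R h (\<zeta> ^ k * z)) \<in> {z. norm z < norm (1 + of_real a * z)}"
      using n in_disc[OF z] by (intro convex_sum convex_moebius_image a) (auto intro!: bd)
    then show ?thesis
      by (simp add: H_def scaleR_conv_of_real)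
  qed
  have ne: "1 + of_real a * H z \<noteq> 0" if "z \<in> unit_disc" for z
    using bdH[OF that] by auto
  have holW: "W holomorphic_on unit_disc"
    unfolding W_def by (intro holomorphic_intros holH ne)
  have bdW: "norm (W z) \<le> 1" if "z \<in> unit_disc" for z
    using bdH[OF that] ne[OF that] by (simp add: W_def norm_divide)
  have expand: "g has_fps_expansion fps_expansion g 0" if "g holomorphic_on unit_disc" for g
    using that by (rule has_fps_expansion_fps_expansion[rotated 2]) auto
  have scale: "(\<lambda>z. h (\<zeta> ^ k * z)) has_fps_expansion
      Abs_fps (\<lambda>m. (\<zeta> ^ k) ^ m * fps_nth (fps_expansion h 0) m)" for k
  proof -
    have "fps_expansion (\<lambda>z. h (\<zeta> ^ k * z)) 0 =
        Abs_fps (\<lambda>m. (\<zeta> ^ k) ^ m * fps_nth (fps_expansion h 0) m)"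
      using higher_deriv_compose_linear[OF hol open_ball open_ball, of 0 0 1 "\<zeta> ^ k"] in_disc
      by (auto simp: fps_expansion_def fps_eq_iff)
    then show ?thesis
      using expand[OF holk[of k]] by simp
  qed
  define FH where "FH = (\<Sum>k<n. fps_const (1 / of_nat n) *
      Abs_fps (\<lambda>m. (\<zeta> ^ k) ^ m * fps_nth (fps_expansion h 0) m))"
  have FH: "H has_fps_expansion FH"
    unfolding H_def FH_def by (intro fps_expansion_intros scale)
  have FH_nth: "fps_nth FH m = (\<Sum>k<n. (\<zeta> ^ k) ^ m) / of_nat n * fps_nth (fps_expansion h 0) m" for m
    by (simp add: FH_def fps_sum_nth sum_distrib_right sum_divide_distrib)
  \<comment> \<open>At m = 0 the sum over the roots equals n rather than 0, so this case rests on
    \<open>h 0 = 0\<close>.\<close>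
  have FH_small: "fps_nth FH m = 0" if "m < n" for m
    using that h0 sum_powers_root_of_unity[of m n]
    by (cases "m = 0") (auto simp: FH_nth \<zeta>_def fps_expansion_def)
  have "\<zeta> ^ n = 1"
    using n by (simp add: \<zeta>_def flip: exp_of_nat_mult)
  then have "(\<zeta> ^ k) ^ n = 1" for k
    by (metis power_commutes power_mult mult.commute power_one)
  then have FH_n: "fps_nth FH n = fps_nth (fps_expansion h 0) n"
    using n by (simp add: FH_nth)
  define FW where "FW = fps_expansion W 0"
  have FW: "W has_fps_expansion FW"
    using expand[OF holW] by (simp add: FW_def)
  \<comment> \<open>Clearing the denominator of \<open>W\<close> gives W + a W H = H near 0, from
    which coefficients can be compared without dividing power series.\<close>
  have "(\<lambda>z. W z + of_real a * (W z * H z)) has_fps_expansion FW + fps_const (of_real a) * (FW * FH)"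
    by (intro fps_expansion_intros FW FH)
  also have "?this \<longleftrightarrow> H has_fps_expansion FW + fps_const (of_real a) * (FW * FH)"
  proof (rule has_fps_expansion_cong)
    have "eventually (\<lambda>z. z \<in> unit_disc) (nhds (0::complex))"
      by (rule eventually_nhds_in_open) auto
    then show "eventually (\<lambda>z. W z + of_real a * (W z * H z) = H z) (nhds 0)"
    proof eventually_elim
      case (elim z)
      have "W z * (1 + of_real a * H z) = H z"
        using ne[OF elim] by (simp add: W_def)
      then show ?case
        by (simp add: algebra_simps)
    qed
  qed simp
  finally have "FH = FW + fps_const (of_real a) * (FW * FH)"
    using FH fps_expansion_eqI by metis
  then have "fps_nth FH n = fps_nth FW n + of_real a * fps_nth (FW * FH) n"
    by (metis fps_add_nth fps_mult_left_const_nth)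
  also have "fps_nth (FW * FH) n = (\<Sum>i=0..n. fps_nth FW i * fps_nth FH (n - i))"
    by (rule fps_mult_nth)
  \<comment> \<open>For i = 0 the factor from \<open>W\<close> vanishes because
    \<open>W 0 = 0\<close>; for i > 0 the index n - i is below n, where \<open>FH\<close>
    vanishes.\<close>
  also have "\<dots> = 0"
  proof (rule sum.neutral, safe)
    fix i assume i: "i \<in> {0..n}"
    have "fps_nth FW 0 = 0"
      using FH_small[of 0] n has_fps_expansion_imp_0_eq_fps_nth_0[OF FH]
      by (simp add: FW_def fps_expansion_def W_def)
    then show "fps_nth FW i * fps_nth FH (n - i) = 0"
      using i n FH_small[of "n - i"] by (cases "i = 0") auto
  qed
  finally have "fps_nth (fps_expansion h 0) n = fps_nth FW n"
    by (simp add: FH_n)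
  then show ?thesis
    using norm_fps_expansion_le_1[OF holW bdW] by (simp add: FW_def)
qed

text \<open>For h = \<omega> / (1 - a \<omega>) one has 1 + a h = 1 / (1 - a \<omega>), so |h| < |1
  + a h| is just |\<omega>| < 1.\<close>

lemma norm_fps_expansion_moebius_compose_le_1:
  assumes hol: "\<omega> holomorphic_on unit_disc" and self: "\<omega> \<in> unit_disc \<rightarrow> unit_disc" and w0: "\<omega> 0 = 0"
    and a: "\<bar>a\<bar> \<le> 1" and n: "n > 0"
  shows "(\<lambda>z. \<omega> z / (1 - of_real a * \<omega> z)) holomorphic_on unit_disc"
    and "norm (fps_nth (fps_expansion (\<lambda>z. \<omega> z / (1 - of_real a * \<omega> z)) 0) n) \<le> 1"
proof -
  have lt: "norm (\<omega> z) < 1" if "z \<in> unit_disc" for z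
    using self that by (auto simp: Pi_iff)
  have ne: "1 - of_real a * \<omega> z \<noteq> 0" if "z \<in> unit_disc" for z
  proof
    assume "1 - of_real a * \<omega> z = 0"
    then have "norm (of_real a * \<omega> z) = 1" by simp
    moreover have "\<bar>a\<bar> * norm (\<omega> z) \<le> 1 * norm (\<omega> z)"
      using a by (intro mult_right_mono) auto
    ultimately show False
      using lt[OF that] by (simp add: norm_mult)
  qed
  show hol': "(\<lambda>z. \<omega> z / (1 - of_real a * \<omega> z)) holomorphic_on unit_disc"
    by (intro holomorphic_intros hol ne)
  show "norm (fps_nth (fps_expansion (\<lambda>z. \<omega> z / (1 - of_real a * \<omega> z)) 0) n) \<le> 1"
  proof (rule norm_fps_expansion_moebius_subordinate_le_1[OF hol' _ _ a n])
    fix z :: complex assume z: "z \<in> unit_disc"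
    have "1 + of_real a * (\<omega> z / (1 - of_real a * \<omega> z)) = 1 / (1 - of_real a * \<omega> z)"
      using ne[OF z] by (simp add: field_simps)
    then show "norm (\<omega> z / (1 - of_real a * \<omega> z)) < norm (1 + of_real a * (\<omega> z / (1 - of_real a * \<omega> z)))"
      using lt[OF z] ne[OF z] by (simp add: norm_divide divide_strict_right_mono)
  qed (simp add: w0)
qed

section \<open>Decomposition of \<open>F_booth\<close>\<close>

lemma one_minus_booth_nonzero:
  fixes z :: complex
  assumes "0 \<le> \<alpha>" "\<alpha> \<le> 1" "norm z < 1"
  shows "1 - of_real \<alpha> * z ^ 2 \<noteq> 0"
proof
  assume "1 - of_real \<alpha> * z ^ 2 = 0"
  then have "norm (of_real \<alpha> * z ^ 2) = 1" by simp
  moreover have "\<alpha> * norm z ^ 2 \<le> 1 * norm z ^ 2"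
    using assms by (intro mult_right_mono) auto
  moreover have "norm z ^ 2 < 1"
    using assms by (simp add: power_less_one_iff)
  ultimately show False
    using assms by (simp add: norm_mult norm_power)
qed

text \<open>With s = sqrt \<alpha> the denominator factors as (1 - s z)(1 + s z); both factors are
  nonzero because their product is.\<close>

lemma F_booth_partial_fractions:
  assumes "0 \<le> \<alpha>" "\<alpha> \<le> 1" "norm z < 1"
  shows "F_booth \<alpha> z =
    1 / 2 * (z / (1 - of_real (sqrt \<alpha>) * z) + z / (1 - of_real (- sqrt \<alpha>) * z))"
proof -
  define s :: complex where "s = of_real (sqrt \<alpha>)"
  have s: "s ^ 2 = of_real \<alpha>"
    using assms(1) unfolding s_def by (simp flip: of_real_power)
  have eq: "1 - of_real \<alpha> * z ^ 2 = (1 - s * z) * (1 + s * z)"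
    unfolding s[symmetric] by (simp add: algebra_simps power2_eq_square)
  have "1 - s * z \<noteq> 0" "1 + s * z \<noteq> 0"
    using one_minus_booth_nonzero[OF assms] eq by auto
  then show ?thesis
    unfolding F_booth_def eq by (simp flip: s_def add: field_simps)
qed

section \<open>From the logarithmic derivative to the coefficient bound\<close>

text \<open>Differentiate f(z) = z exp(L(z)). At the origin both sides vanish, thanks to the value 1
  prescribed in \<open>log_diff\<close>.\<close>

lemma deriv_log_branch:
  assumes f: "f \<in> class_A" and L: "is_log_branch f L" and z: "z \<in> unit_disc"
  shows "z * deriv L z = log_diff f z - 1"
proof (cases "z = 0")
  case False
  have holL: "L holomorphic_on unit_disc"
    and f0: "f 0 = 0"
    using f L by (auto simp: is_log_branch_def class_A_def)
  have e: "f z = z * exp (L z)" if "z \<in> unit_disc" for z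
    using L that f0 by (cases "z = 0") (auto simp: is_log_branch_def)
  have DL: "(L has_field_derivative deriv L z) (at z)"
    using holL z by (intro holomorphic_derivI) auto
  have "((\<lambda>z. z * exp (L z)) has_field_derivative exp (L z) * (1 + z * deriv L z)) (at z)"
    by (auto intro!: derivative_eq_intros DL simp: algebra_simps)
  then have "(f has_field_derivative exp (L z) * (1 + z * deriv L z)) (at z)"
    by (rule has_field_derivative_transform_within_open[OF _ open_ball z]) (simp add: e)
  then have "deriv f z = exp (L z) * (1 + z * deriv L z)"
    by (rule DERIV_imp_deriv)
  then show ?thesis
    using False by (simp add: log_diff_def e[OF z])
qed (simp add: log_diff_def)

text \<open>Transfers coefficient information from z L'(z) to L; this is the source of the factor n
  in the bound.\<close>

lemma fps_expansion_times_deriv_nth: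
  assumes "L holomorphic_on unit_disc"
  shows "fps_nth (fps_expansion (\<lambda>z. z * deriv L z) 0) n = of_nat n * fps_nth (fps_expansion L 0) n"
proof -
  have "L has_fps_expansion fps_expansion L 0"
    by (rule has_fps_expansion_fps_expansion[OF open_ball _ assms]) auto
  then have "(\<lambda>z. z * deriv L z) has_fps_expansion fps_X * fps_deriv (fps_expansion L 0)"
    by (intro fps_expansion_intros)
  then have "fps_expansion (\<lambda>z. z * deriv L z) 0 = fps_X * fps_deriv (fps_expansion L 0)"
    by (rule fps_expansion_eqI)
  then show ?thesis
    by (cases n) auto
qed

text \<open>The triangle inequality bounds the n-th coefficient of z L'(z), a mean of two
  coefficients of modulus at most 1. Dividing by n, and by the 2 in \<open>log_coeff\<close>, gives
  the claim.\<close>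

lemma norm_log_coeff_le:
  assumes \<alpha>: "0 \<le> \<alpha>" "\<alpha> \<le> 1" and f: "f \<in> BS \<alpha>" and n: "n \<ge> 1"
  shows "norm (log_coeff f n) \<le> 1 / (2 * real n)"
proof -
  define L where "L = log_branch f"
  have L: "is_log_branch f L"
    unfolding L_def using f by (rule is_log_branch_log_branch)
  then have holL: "L holomorphic_on unit_disc"
    by (simp add: is_log_branch_def)
  have fA: "f \<in> class_A"
    using f by (simp add: BS_def)
  obtain \<omega> where w: "\<omega> holomorphic_on unit_disc" "\<omega> \<in> unit_disc \<rightarrow> unit_disc" "\<omega> 0 = 0"
    and eq: "\<And>z. z \<in> unit_disc \<Longrightarrow> log_diff f z - 1 = F_booth \<alpha> (\<omega> z)"
    using f by (auto simp: BS_def subordinate_def)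
  define m where "m a = (\<lambda>z. \<omega> z / (1 - of_real a * \<omega> z))" for a :: real
  define s where "s = sqrt \<alpha>"
  have s: "\<bar>s\<bar> \<le> 1" "\<bar>-s\<bar> \<le> 1"
    using \<alpha> by (auto simp: s_def)
  have bound: "norm (fps_nth (fps_expansion (m a) 0) n) \<le> 1"
    and exp_m: "m a has_fps_expansion fps_expansion (m a) 0" if "\<bar>a\<bar> \<le> 1" for a
    using norm_fps_expansion_moebius_compose_le_1[OF w that, of n] n
      has_fps_expansion_fps_expansion[of unit_disc "m a"]
    by (auto simp: m_def)
  have "(\<lambda>z. 1 / 2 * (m s z + m (-s) z)) has_fps_expansion
      fps_const (1 / 2) * (fps_expansion (m s) 0 + fps_expansion (m (-s)) 0)"
    by (intro fps_expansion_intros exp_m s)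
  also have "?this \<longleftrightarrow> (\<lambda>z. z * deriv L z) has_fps_expansion
      fps_const (1 / 2) * (fps_expansion (m s) 0 + fps_expansion (m (-s)) 0)"
  proof (rule has_fps_expansion_cong)
    have "eventually (\<lambda>z. z \<in> unit_disc) (nhds (0::complex))"
      by (rule eventually_nhds_in_open) auto
    then show "eventually (\<lambda>z. 1 / 2 * (m s z + m (-s) z) = z * deriv L z) (nhds 0)"
    proof eventually_elim
      case (elim z)
      then have "norm (\<omega> z) < 1"
        using w(2) by (auto simp: Pi_iff)
      from F_booth_partial_fractions[OF \<alpha> this] show ?case
        by (simp add: deriv_log_branch[OF fA L elim] eq[OF elim] m_def s_def)
    qed
  qed simp
  finally have "of_nat n * fps_nth (fps_expansion L 0) n =
      1 / 2 * (fps_nth (fps_expansion (m s) 0) n + fps_nth (fps_expansion (m (-s)) 0) n)"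
    by (simp add: fps_expansion_eqI flip: fps_expansion_times_deriv_nth[OF holL])
  then have "norm (of_nat n * fps_nth (fps_expansion L 0) n) =
      1 / 2 * norm (fps_nth (fps_expansion (m s) 0) n + fps_nth (fps_expansion (m (-s)) 0) n)"
    by (simp only: norm_mult) simp
  also have "\<dots> \<le> 1"
    using norm_triangle_le[of "fps_nth (fps_expansion (m s) 0) n"
        "fps_nth (fps_expansion (m (-s)) 0) n" 2] bound[OF s(1)] bound[OF s(2)] by simp
  finally have "real n * norm (fps_nth (fps_expansion L 0) n) \<le> 1"
    by (simp add: norm_mult)
  then show ?thesis
    using n by (simp add: log_coeff_def norm_divide field_simps flip: L_def)
qed

section \<open>Sharpness\<close>

text \<open>The extremal function has Schwarz function $\omega(z) = z^n$.\<close>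

lemma exists_norm_log_coeff_eq:
  assumes \<alpha>: "0 \<le> \<alpha>" "\<alpha> \<le> 1" and n: "n \<ge> 1"
  shows "\<exists>f\<in>BS \<alpha>. norm (log_coeff f n) = 1 / (2 * real n)"
proof -
  \<comment> \<open>This is F_\<alpha>(z^n) / z with the singularity at 0 cancelled, hence the
    exponent n - 1. It has to be the derivative of log(f(z)/z).\<close>
  define g where "g = (\<lambda>z::complex. z ^ (n - 1) / (1 - of_real \<alpha> * (z ^ n) ^ 2))"
  have lt: "norm (z ^ n) < 1" if "z \<in> unit_disc" for z :: complex
    using that n by (simp add: norm_power power_less_one_iff)
  note ne = one_minus_booth_nonzero[OF \<alpha> lt]
  have holg: "g holomorphic_on unit_disc"
    unfolding g_def by (intro holomorphic_intros ne)
  obtain P where P: "\<And>z. z \<in> unit_disc \<Longrightarrow> (P has_field_derivative g z) (at z within unit_disc)"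
    using holomorphic_convex_primitive'[OF convex_ball open_ball holg] by blast
  define L where "L = (\<lambda>z. P z - P 0)"
  have DL: "(L has_field_derivative g z) (at z)" if "z \<in> unit_disc" for z
    using P[OF that] at_within_open[OF that open_ball]
    by (auto simp: L_def intro!: derivative_eq_intros)
  have holL: "L holomorphic_on unit_disc"
    using DL by (meson field_differentiable_at_within field_differentiable_def holomorphic_onI)
  have L0: "L 0 = 0"
    by (simp add: L_def)
  \<comment> \<open>Recovering \<open>f\<close> from \<open>L\<close> makes \<open>L\<close> a
    logarithm of f(z)/z by construction; \<open>L 0 = 0\<close> gives f'(0) = 1.\<close>
  define f where "f = (\<lambda>z. z * exp (L z))"
  have Df: "(f has_field_derivative exp (L z) * (1 + z * g z)) (at z)" if "z \<in> unit_disc" for z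
    unfolding f_def by (auto intro!: derivative_eq_intros DL that simp: algebra_simps)
  have fA: "f \<in> class_A"
    using DERIV_imp_deriv[OF Df[of 0]]
    by (auto simp: class_A_def f_def L0 intro!: holomorphic_intros holL)
  have L: "is_log_branch f L"
    by (auto simp: is_log_branch_def holL L0 f_def)
  have deriv_L: "z * deriv L z = F_booth \<alpha> (z ^ n)" if "z \<in> unit_disc" for z
    using n unfolding DERIV_imp_deriv[OF DL[OF that]]
    by (simp add: g_def F_booth_def power_eq_if)
  have ld: "log_diff f z - 1 = F_booth \<alpha> (z ^ n)" if "z \<in> unit_disc" for z
    using deriv_log_branch[OF fA L that] deriv_L[OF that] by simp
  have holF: "F_booth \<alpha> holomorphic_on unit_disc"
    unfolding F_booth_def
    by (intro holomorphic_intros one_minus_booth_nonzero \<alpha>) auto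
  have "(\<lambda>z. F_booth \<alpha> (z ^ n)) holomorphic_on unit_disc"
    unfolding F_booth_def by (intro holomorphic_intros ne)
  then have "(\<lambda>z. log_diff f z - 1) holomorphic_on unit_disc"
    by (rule holomorphic_transform) (simp add: ld)
  then have "(\<lambda>z. log_diff f z - 1) \<prec>\<^sub>s F_booth \<alpha>"
    unfolding subordinate_def using holF ld lt n
    by (intro conjI exI[of _ "\<lambda>z. z ^ n"]) (auto intro!: holomorphic_intros simp: Pi_iff)
  then have f: "f \<in> BS \<alpha>"
    using fA by (auto simp: BS_def f_def)
  \<comment> \<open>\<open>log_branch\<close> is a choice, so uniqueness on the disc is what
    identifies its coefficients with those of \<open>L\<close>.\<close>
  have "fps_expansion (log_branch f) 0 = fps_expansion L 0"
  proof (rule fps_expansion_cong)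
    have "eventually (\<lambda>z. z \<in> unit_disc) (nhds (0::complex))"
      by (rule eventually_nhds_in_open) auto
    then show "eventually (\<lambda>z. log_branch f z = L z) (nhds 0)"
      by eventually_elim (rule is_log_branch_unique[OF is_log_branch_log_branch[OF f] L])
  qed
  moreover have "of_nat n * fps_nth (fps_expansion L 0) n = 1"
  proof -
    \<comment> \<open>z L'(z) is z^n times the reciprocal of \<open>D\<close>, so its n-th
      coefficient is the constant term of that reciprocal, namely 1.\<close>
    define D :: "complex fps" where "D = 1 - fps_const (of_real \<alpha>) * (fps_X ^ n) ^ 2"
    have D0: "fps_nth D 0 = 1"
      using n by (simp add: D_def flip: power_mult)
    have "(\<lambda>z. z ^ n * (1 / (1 - of_real \<alpha> * (z ^ n) ^ 2))) has_fps_expansion fps_X ^ n * (1 / D)"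
      unfolding D_def by (intro fps_expansion_intros) (simp add: D0 flip: D_def)
    also have "?this \<longleftrightarrow> (\<lambda>z. z * deriv L z) has_fps_expansion fps_X ^ n * (1 / D)"
    proof (rule has_fps_expansion_cong)
      have "eventually (\<lambda>z. z \<in> unit_disc) (nhds (0::complex))"
        by (rule eventually_nhds_in_open) auto
      then show "eventually (\<lambda>z. z ^ n * (1 / (1 - of_real \<alpha> * (z ^ n) ^ 2)) = z * deriv L z) (nhds 0)"
        by eventually_elim (simp add: deriv_L F_booth_def)
    qed simp
    finally have "fps_nth (fps_expansion (\<lambda>z. z * deriv L z) 0) n = fps_nth (1 / D) 0"
      by (simp add: fps_expansion_eqI fps_X_power_mult_nth)
    also have "\<dots> = 1"
      using D0 by (simp add: fps_divide_unit)
    finally show ?thesis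
      by (simp add: fps_expansion_times_deriv_nth[OF holL])
  qed
  ultimately have "log_coeff f n = 1 / (2 * of_nat n)"
    using n by (simp add: log_coeff_def field_simps)
  then have "norm (log_coeff f n) = 1 / (2 * real n)"
    by (simp add: norm_divide norm_mult)
  with f show ?thesis by blast
qed

theorem theorem2p2:
  fixes \<alpha> :: real
  assumes "0 \<le> \<alpha>" and "\<alpha> \<le> 1"
  shows "(\<forall>n\<in>{1, 2, 3}. (\<forall>f\<in>BS \<alpha>. norm (log_coeff f n) \<le> 1 / (2 * real n)) \<and>
                         (\<exists>f\<in>BS \<alpha>. norm (log_coeff f n) = 1 / (2 * real n))) \<and>
         (\<alpha> \<le> 3 - 2 * sqrt 2 \<longrightarrow>
           (\<forall>n\<ge>1. (\<forall>f\<in>BS \<alpha>. norm (log_coeff f n) \<le> 1 / (2 * real n)) \<and>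
                   (\<exists>f\<in>BS \<alpha>. norm (log_coeff f n) = 1 / (2 * real n)))) \<and>
         (\<forall>f\<in>BS \<alpha>. \<forall>n\<ge>1. norm (log_coeff f n) \<le> 1 / 2)"
proof -
  \<comment> \<open>Bound and attainment for every n \<ge> 1 yield the first two conjuncts; the
    third weakens the bound using 1 / (2n) \<le> 1 / 2.\<close>
  have sharp: "(\<forall>f\<in>BS \<alpha>. norm (log_coeff f n) \<le> 1 / (2 * real n)) \<and>
      (\<exists>f\<in>BS \<alpha>. norm (log_coeff f n) = 1 / (2 * real n))" if "n \<ge> 1" for n
    using norm_log_coeff_le[OF assms] exists_norm_log_coeff_eq[OF assms] that by blast
  have "norm (log_coeff f n) \<le> 1 / 2" if "f \<in> BS \<alpha>" "n \<ge> 1" for f n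
  proof -
    have "norm (log_coeff f n) \<le> 1 / (2 * real n)"
      using sharp that by blast
    also have "\<dots> \<le> 1 / 2"
      using that by (simp add: field_simps)
    finally show ?thesis .
  qed
  moreover have "n \<ge> 1" if "n \<in> {1, 2, 3}" for n :: nat
    using that by auto
  ultimately show ?thesis
    using sharp by blast
qed

end
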